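(* Let $r\ge 3$ be an integer and let $H$ be a tournament with $\chi(H)=r$. Then for $n \ge |V(H)|$, $$\left(1-\frac{1}{r-1}\right)\binom{n}{2} \le t(T_n,H) \le t(n,H)=\left(1-\frac{1}{r-1}+o_n(1)\right)\binom{n}{2},$$ where $H$ is fixed and $o_n(1)\to 0$ as $n\to\infty$.
   Context: A tournament is a digraph having exactly one of the edges $(u,v),(v,u)$ for every pair of distinct vertices $u,v$. A set of vertices of a tournament is transitive if the sub-tournament it induces has no directed cycle. $T_n$ is the transitive tournament on $n$ vertices. The chromatic number $\chi(H)$ of a tournament $H$ is the minimum $k$ such that $V(H)$ can be partitioned into $k$ transitive sets. Adding an edge to a tournament means adding the reverse $(v,u)$ of some existing edge $(u,v)$; the pair $\{u,v\}$ then becomes bidirectional (both orientations present). A digraph contains a copy of $H$ if it has a (not necessarily induced) subgraph isomorphic to $H$. For a tournament $H$ and $n\ge |V(H)|$: $t(n,H)$ is the smallest integer $t$ such that adding any $t$ edges to any $n$-vertex tournament results in a digraph containing a copy of $H$; $t(T_n,H)$ is the smallest integer $t$ such that adding any $t$ edges to $T_n$ results in a digraph containing a copy of $H$. *)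

theory Defs
  imports Complex_Main "HOL-Library.Disjoint_Sets" "Graph_Theory.Graph_Theory"
begin

text \<open>
  Digraphs without parallel arcs are records of type \<^typ>\<open>'a pair_pre_digraph\<close>; the constant
  \<^const>\<open>with_proj\<close> embeds them into the general digraphs, for which cycles, subgraphs and
  isomorphisms are defined. The locale \<^locale>\<open>pair_digraph\<close> says finite, loop-free and well-formed.
\<close>

definition tournament :: "'a pair_pre_digraph \<Rightarrow> bool" where
  "tournament G \<longleftrightarrow> pair_digraph G \<and>
     (\<forall>u \<in> pverts G. \<forall>v \<in> pverts G. u \<noteq> v \<longrightarrow> ((u, v) \<in> parcs G \<longleftrightarrow> (v, u) \<notin> parcs G))"

definition transitive_set :: "'a pair_pre_digraph \<Rightarrow> 'a set \<Rightarrow> bool" where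
  "transitive_set G S \<longleftrightarrow> S \<subseteq> pverts G \<and>
     \<not> (\<exists>p. pre_digraph.cycle (induce_subgraph (with_proj G) S) p)"

definition chromatic_number :: "'a pair_pre_digraph \<Rightarrow> nat" where
  "chromatic_number H =
     (LEAST k. \<exists>P. partition_on (pverts H) P \<and> card P = k \<and> (\<forall>S \<in> P. transitive_set H S))"

definition transitive_tournament :: "nat \<Rightarrow> nat pair_pre_digraph" where
  "transitive_tournament n = \<lparr> pverts = {..<n}, parcs = {(i, j). i < j \<and> j < n} \<rparr>"

definition add_reverses :: "'a pair_pre_digraph \<Rightarrow> ('a \<times> 'a) set \<Rightarrow> 'a pair_pre_digraph" where
  "add_reverses G F = \<lparr> pverts = pverts G, parcs = parcs G \<union> F\<inverse> \<rparr>"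

definition contains_copy :: "'a pair_pre_digraph \<Rightarrow> 'b pair_pre_digraph \<Rightarrow> bool" where
  "contains_copy G H \<longleftrightarrow> (\<exists>K. subgraph K (with_proj G) \<and> digraph_iso (with_proj H) K)"

definition forces_copy :: "'a pair_pre_digraph \<Rightarrow> nat \<Rightarrow> 'b pair_pre_digraph \<Rightarrow> bool" where
  "forces_copy G t H \<longleftrightarrow>
     (\<forall>F \<subseteq> parcs G. card F = t \<longrightarrow> contains_copy (add_reverses G F) H)"

text \<open>
  For \<open>n \<ge> card (pverts H)\<close> both minima below are over nonempty sets: adding all
  \<open>n choose 2\<close> reverse arcs gives the complete digraph. Every \<open>n\<close>-vertex tournament has an
  isomorphic copy with vertices in \<^typ>\<open>nat\<close>, so that vertex type loses no generality.
\<close>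

definition t_num :: "nat \<Rightarrow> 'b pair_pre_digraph \<Rightarrow> nat" where
  "t_num n H = (LEAST t. \<forall>G :: nat pair_pre_digraph.
     tournament G \<and> card (pverts G) = n \<longrightarrow> forces_copy G t H)"

definition t_trans :: "nat \<Rightarrow> 'b pair_pre_digraph \<Rightarrow> nat" where
  "t_trans n H = (LEAST t. forces_copy (transitive_tournament n) t H)"

end

theory Submission
  imports Defs
begin

text \<open>
  Write \<open>k = r - 1\<close>. The threshold is the Turan density \<open>1 - 1 / k\<close> because only the graph formed by the
  bidirectional pairs matters asymptotically.

  For the lower bound, reverse arcs of the transitive tournament precisely between different residue
  classes modulo \<open>k\<close>. Each class remains transitive, so a copy of \<open>H\<close> would yield a colouring of \<open>H\<close>
  with only \<open>k\<close> transitive sets (\<open>no_copy_in_turan_reversal\<close>), and already at least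
  \<open>(1 - 1 / k) (n choose 2)\<close> arcs have been added (\<open>card_turan_arcs_ge\<close>).

  For the upper bound, suppose that at least a fraction \<open>1 - 1 / k + \<delta>\<close> of all pairs of a large tournament is
  bidirectional. By the Erdos--Stone theorem (\<open>erdos_stone\<close>) the graph of bidirectional pairs
  contains a complete \<open>r\<close>-partite graph with parts of size \<open>2 ^ h\<close>, where \<open>h\<close> is the number of
  vertices of \<open>H\<close>. Each part contains a transitive subtournament on \<open>h\<close> vertices
  (\<open>sorted_sequence_in_tournament\<close>). A colouring of \<open>H\<close> by \<open>r\<close> transitive sets now embeds class
  by class: inside a class the order of the transitive sets is respected, and between classes every
  orientation is available (\<open>contains_copy_if_multipartite\<close>).

  The Erdos--Stone theorem is proved in the classical way: a dense graph has a large subset with high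
  minimum degree, and under a minimum-degree condition the parts are found one at a time by counting
  and the pigeonhole principle.
\<close>

section \<open>Tournaments, copies and transitive sets\<close>

lemma tournamentD:
  assumes "tournament G"
  shows "finite (pverts G)" and "finite (parcs G)" and "parcs G \<subseteq> pverts G \<times> pverts G" and "pair_wf_digraph G"
    and "(u, v) \<in> parcs G \<Longrightarrow> u \<noteq> v" and "(u, v) \<in> parcs G \<Longrightarrow> (v, u) \<notin> parcs G"
    and "\<lbrakk>u \<in> pverts G; v \<in> pverts G; u \<noteq> v\<rbrakk> \<Longrightarrow> (u, v) \<in> parcs G \<or> (v, u) \<in> parcs G"
proof -
  interpret pair_digraph G using assms unfolding tournament_def by blast
  show "finite (pverts G)" "finite (parcs G)" "parcs G \<subseteq> pverts G \<times> pverts G"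
    by (auto simp: in_arcsD1 in_arcsD2)
  show "pair_wf_digraph G" by unfold_locales
  show loop: "(u, v) \<in> parcs G \<Longrightarrow> u \<noteq> v" using pair_no_loops by fastforce
  show "(u, v) \<in> parcs G \<Longrightarrow> (v, u) \<notin> parcs G"
    using assms loop in_arcsD1 in_arcsD2 unfolding tournament_def by blast
  show "\<lbrakk>u \<in> pverts G; v \<in> pverts G; u \<noteq> v\<rbrakk> \<Longrightarrow> (u, v) \<in> parcs G \<or> (v, u) \<in> parcs G"
    using assms unfolding tournament_def by blast
qed

lemma add_reverses_simps [simp]:
  "pverts (add_reverses G F) = pverts G"
  "parcs (add_reverses G F) = parcs G \<union> F\<inverse>"
  by (simp_all add: add_reverses_def)

lemma contains_copyI:
  assumes "pair_wf_digraph H" and "pair_wf_digraph G"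
    and inj: "inj_on f (pverts H)" and verts: "f ` pverts H \<subseteq> pverts G"
    and arcs: "\<And>u v. (u, v) \<in> parcs H \<Longrightarrow> (f u, f v) \<in> parcs G"
  shows "contains_copy G H"
proof -
  let ?iso = "\<lparr>iso_verts = f, iso_arcs = map_prod f f, iso_head = snd, iso_tail = fst\<rparr>"
  let ?K = "app_iso ?iso (with_proj H)"
  interpret H: pair_wf_digraph H by fact
  interpret G: pair_wf_digraph G by fact
  have "inj_on (map_prod f f) (pverts H \<times> pverts H)"
    using inj by (rule map_prod_inj_on[OF inj])
  then have "inj_on (map_prod f f) (parcs H)"
    by (rule inj_on_subset) (auto intro: H.in_arcsD1 H.in_arcsD2)
  then have iso: "pre_digraph.digraph_isomorphism (with_proj H) ?iso"
    unfolding pre_digraph.digraph_isomorphism_def using inj H.wf_digraph_axioms by auto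
  have "wf_digraph ?K"
    using wf_digraph.wf_digraphI_app_iso[OF H.wf_digraph_axioms iso] .
  then have "subgraph ?K (with_proj G)"
    using verts arcs G.wf_digraph_axioms by (intro subgraphI) (auto simp: compatible_def)
  then show ?thesis
    unfolding contains_copy_def digraph_iso_def using iso by blast
qed

text \<open>
  Arcs of a copy are pairs with the projections as end points, so the vertex map of the isomorphism determines its arc map.
\<close>
lemma contains_copyE:
  assumes "contains_copy G H"
  obtains f where "f ` pverts H \<subseteq> pverts G" and "\<And>u v. (u, v) \<in> parcs H \<Longrightarrow> (f u, f v) \<in> parcs G"
proof -
  from assms obtain iso where K: "subgraph (app_iso iso (with_proj H)) (with_proj G)"
    and iso: "pre_digraph.digraph_isomorphism (with_proj H) iso"
    unfolding contains_copy_def digraph_iso_def by blast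
  have "iso_arcs iso (u, v) = (iso_verts iso u, iso_verts iso v)" if "(u, v) \<in> parcs H" for u v
    using K iso that by (auto simp: subgraph_def compatible_def pre_digraph.digraph_isomorphism_def prod_eq_iff)
  moreover have "iso_arcs iso ` parcs H \<subseteq> parcs G" "iso_verts iso ` pverts H \<subseteq> pverts G"
    using K by (auto simp: subgraph_def)
  ultimately show thesis
    using that[of "iso_verts iso"] by (metis image_subset_iff)
qed

lemma cas_strictly_increasing:
  fixes g :: "'a \<Rightarrow> nat"
  assumes "pre_digraph.cas G u p v" and "\<And>e. e \<in> set p \<Longrightarrow> g (tail G e) < g (head G e)" and "p \<noteq> []"
  shows "g u < g v"
  using assms
proof (induction p arbitrary: u)
  case (Cons e p)
  then show ?case
    by (cases p) (fastforce simp: pre_digraph.cas.simps)+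
qed simp

text \<open>
  A numbering that increases along every arc rules out closed walks.
\<close>
lemma transitive_setI:
  fixes g :: "'a \<Rightarrow> nat"
  assumes "S \<subseteq> pverts G"
    and "\<And>u v. \<lbrakk>u \<in> S; v \<in> S; (u, v) \<in> parcs G\<rbrakk> \<Longrightarrow> g u < g v"
  shows "transitive_set G S"
  unfolding transitive_set_def
proof (intro conjI notI, fact, elim exE)
  fix p assume "pre_digraph.cycle (with_proj G \<restriction> S) p"
  then obtain u where p: "pre_digraph.awalk (with_proj G \<restriction> S) u p u" "p \<noteq> []"
    unfolding pre_digraph.cycle_def by blast
  then have "g u < g u"
    using assms(2) unfolding pre_digraph.awalk_def
    by (intro cas_strictly_increasing[of "with_proj G \<restriction> S" u p u g]) auto
  then show False by simp
qed

text \<open>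
  In a tournament the absence of the arc \<open>(u, w)\<close> would close a directed triangle.
\<close>
lemma transitive_set_transitive:
  assumes "tournament H" and "transitive_set H S" and "u \<in> S" "v \<in> S" "w \<in> S"
    and uv: "(u, v) \<in> parcs H" and vw: "(v, w) \<in> parcs H"
  shows "(u, w) \<in> parcs H"
proof (rule ccontr)
  assume "(u, w) \<notin> parcs H"
  note H = tournamentD[OF \<open>tournament H\<close>]
  have "u \<noteq> w" using uv vw H(6) by blast
  then have wu: "(w, u) \<in> parcs H"
    using \<open>(u, w) \<notin> parcs H\<close> H(3,7) uv vw by blast
  have "pre_digraph.cycle (with_proj H \<restriction> S) [(u, v), (v, w), (w, u)]"
    using assms wu \<open>u \<noteq> w\<close> H(5)[OF uv] H(5)[OF vw]
    by (auto simp: pre_digraph.cycle_def pre_digraph.awalk_def pre_digraph.cas.simps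
        pre_digraph.awalk_verts.simps intro!: exI[of _ u])
  then show False using \<open>transitive_set H S\<close> unfolding transitive_set_def by blast
qed

text \<open>
  As the arcs within \<open>S\<close> form a strict linear order, counting the predecessors of a vertex gives its position in that order.
\<close>
lemma transitive_set_rank:
  assumes "tournament H" and "transitive_set H S"
  obtains g :: "'a \<Rightarrow> nat" where "\<And>u. u \<in> S \<Longrightarrow> g u < card (pverts H)"
    and "\<And>u v. \<lbrakk>u \<in> S; v \<in> S; (u, v) \<in> parcs H\<rbrakk> \<Longrightarrow> g u < g v"
proof -
  note H = tournamentD[OF \<open>tournament H\<close>]
  have S: "S \<subseteq> pverts H" "finite S"
    using assms(2) H(1) finite_subset unfolding transitive_set_def by auto
  let ?below = "\<lambda>u. {v \<in> S. (v, u) \<in> parcs H}"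
  show thesis
  proof (rule that[of "\<lambda>u. card (?below u)"])
    fix u assume "u \<in> S"
    then have "?below u \<subset> pverts H" using S(1) H(5) by blast
    then show "card (?below u) < card (pverts H)" using H(1) psubset_card_mono by blast
  next
    fix u v assume uv: "u \<in> S" "v \<in> S" "(u, v) \<in> parcs H"
    then have "?below u \<subset> ?below v"
      using transitive_set_transitive[OF assms] H(5) by blast
    then show "card (?below u) < card (?below v)"
      using S(2) by (intro psubset_card_mono) auto
  qed
qed

lemma chromatic_number_le:
  assumes "partition_on (pverts H) P" and "\<And>S. S \<in> P \<Longrightarrow> transitive_set H S"
  shows "chromatic_number H \<le> card P"
  unfolding chromatic_number_def using assms by (intro Least_le exI[of _ P]) auto

lemma singleton_colouring:
  assumes "tournament H"
  shows "partition_on (pverts H) ((\<lambda>u. {u}) ` pverts H)"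
    and "\<forall>S \<in> (\<lambda>u. {u}) ` pverts H. transitive_set H S"
  using tournamentD(5)[OF assms]
  by (auto simp: partition_on_def disjoint_def intro!: transitive_setI[where g = "\<lambda>_. 0"])

lemma chromatic_number_le_card:
  assumes "tournament H"
  shows "chromatic_number H \<le> card (pverts H)"
proof -
  have "chromatic_number H \<le> card ((\<lambda>u. {u}) ` pverts H)"
    using singleton_colouring[OF assms] by (intro chromatic_number_le) auto
  also have "\<dots> = card (pverts H)" by (intro card_image) auto
  finally show ?thesis .
qed

lemma optimal_colouring:
  assumes "tournament H"
  obtains P where "partition_on (pverts H) P" and "card P = chromatic_number H"
    and "\<And>S. S \<in> P \<Longrightarrow> transitive_set H S"
proof -
  have "\<exists>P. partition_on (pverts H) P \<and> card P = chromatic_number H \<and> (\<forall>S \<in> P. transitive_set H S)"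
    unfolding chromatic_number_def
    by (rule LeastI_ex) (use singleton_colouring[OF assms] in blast)
  then show thesis using that by blast
qed

section \<open>Reversing a Turan graph in the transitive tournament\<close>

text \<open>
  The balanced complete \<open>k\<close>-partite graph with the residue classes modulo \<open>k\<close> as parts, each edge given as an increasing pair.
\<close>
definition turan_arcs :: "nat \<Rightarrow> nat \<Rightarrow> (nat \<times> nat) set" where
  "turan_arcs k n = {(i, j). i < j \<and> j < n \<and> i mod k \<noteq> j mod k}"

lemma finite_turan_arcs [simp]: "finite (turan_arcs k n)"
  by (rule finite_subset[of _ "{..<n} \<times> {..<n}"]) (auto simp: turan_arcs_def)

lemma card_congruent_below_le:
  fixes k n :: nat
  assumes "k > 0"
  shows "card {i. i < n \<and> i mod k = n mod k} \<le> n div k"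
proof -
  \<comment> \<open>These numbers are \<open>n - k, n - 2k, \<dots>\<close>.\<close>
  have "{i. i < n \<and> i mod k = n mod k} \<subseteq> (\<lambda>q. n - k * q) ` {1..n div k}"
  proof
    fix i assume "i \<in> {i. i < n \<and> i mod k = n mod k}"
    then have "i < n" and "n mod k = i mod k" by simp_all
    then have "k dvd n - i" by (metis mod_eq_dvd_iff_nat less_imp_le)
    then obtain q where q: "n - i = k * q" by (auto elim: dvdE)
    then have "q \<noteq> 0" "k * q \<le> n" using \<open>i < n\<close> by (auto intro: gr0I)
    then have "q \<in> {1..n div k}"
      using assms by (auto simp: less_eq_div_iff_mult_less_eq mult.commute)
    moreover have "i = n - k * q" using q \<open>i < n\<close> by simp
    ultimately show "i \<in> (\<lambda>q. n - k * q) ` {1..n div k}" by blast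
  qed
  then have "card {i. i < n \<and> i mod k = n mod k} \<le> card {1..n div k}"
    by (intro surj_card_le) auto
  then show ?thesis by simp
qed

text \<open>
  The new vertex \<open>n\<close> shares its residue with at most \<open>n / k\<close> smaller ones, hence contributes at
  least \<open>(1 - 1 / k) n\<close> pairs. Summing gives the bound for all \<open>n\<close>, whether or not \<open>k\<close> divides \<open>n\<close>.
\<close>
lemma card_turan_arcs_ge:
  assumes "k > 0"
  shows "(1 - 1 / real k) * real (n choose 2) \<le> real (card (turan_arcs k n))"
proof (induction n)
  case (Suc n)
  let ?new = "{i. i < n \<and> i mod k \<noteq> n mod k}"
  have "turan_arcs k (Suc n) = turan_arcs k n \<union> (\<lambda>i. (i, n)) ` ?new"
    by (auto simp: turan_arcs_def less_Suc_eq)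
  moreover have "turan_arcs k n \<inter> (\<lambda>i. (i, n)) ` ?new = {}"
    by (auto simp: turan_arcs_def)
  ultimately have "card (turan_arcs k (Suc n)) = card (turan_arcs k n) + card ?new"
    by (simp add: card_Un_disjoint card_image inj_on_def)
  moreover have "real n * (1 - 1 / real k) \<le> real (card ?new)"
  proof -
    have "n = card ({i. i < n \<and> i mod k = n mod k} \<union> ?new)"
      by (subst card_lessThan[symmetric]) (rule arg_cong[where f = card], auto)
    also have "\<dots> \<le> card {i. i < n \<and> i mod k = n mod k} + card ?new" by (rule card_Un_le)
    also have "\<dots> \<le> n div k + card ?new" using card_congruent_below_le[OF assms] by simp
    finally have "real n \<le> real (n div k) + real (card ?new)" by linarith
    moreover have "real (n div k) \<le> real n / real k" by (rule of_nat_div_le_of_nat)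
    ultimately show ?thesis by (simp add: algebra_simps)
  qed
  ultimately show ?case
    using Suc.IH by (simp add: numeral_2_eq_2 algebra_simps)
qed (simp add: numeral_2_eq_2)

lemma tournament_transitive_tournament:
  "tournament (transitive_tournament n)" "card (pverts (transitive_tournament n)) = n"
proof -
  have "finite {(i, j). i < j \<and> j < n}"
    by (rule finite_subset[of _ "{..<n} \<times> {..<n}"]) auto
  then have "pair_digraph (transitive_tournament n)"
    by unfold_locales (auto simp: transitive_tournament_def)
  then show "tournament (transitive_tournament n)"
    unfolding tournament_def by (auto simp: transitive_tournament_def)
qed (simp add: transitive_tournament_def)

text \<open>
  Within a residue class no arc has been reversed, so the class is still ordered numerically. A copy of
  \<open>H\<close> would pull the \<open>k\<close> residue classes back to a colouring of \<open>H\<close> by \<open>k\<close> transitive sets.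
\<close>
lemma no_copy_in_turan_reversal:
  assumes "tournament H" and "k > 0" and "k < chromatic_number H" and F: "F \<subseteq> turan_arcs k n"
  shows "\<not> contains_copy (add_reverses (transitive_tournament n) F) H"
proof
  assume "contains_copy (add_reverses (transitive_tournament n) F) H"
  then obtain f where f: "\<And>u v. (u, v) \<in> parcs H \<Longrightarrow>
      (f u, f v) \<in> parcs (add_reverses (transitive_tournament n) F)"
    by (rule contains_copyE) blast
  \<comment> \<open>Empty residue classes have to be left out of a partition.\<close>
  define P where "P = (\<lambda>c. {u \<in> pverts H. f u mod k = c}) ` {..<k} - {{}}"
  have "partition_on (pverts H) P"
  proof (rule partition_onI)
    have "u \<in> \<Union>P" if "u \<in> pverts H" for u
    proof (rule UnionI)
      show "u \<in> {v \<in> pverts H. f v mod k = f u mod k}" using that by simp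
      then show "{v \<in> pverts H. f v mod k = f u mod k} \<in> P"
        unfolding P_def using \<open>k > 0\<close>
        by (intro DiffI image_eqI[where x = "f u mod k"] refl) auto
    qed
    moreover have "\<Union>P \<subseteq> pverts H" by (auto simp: P_def)
    ultimately show "\<Union>P = pverts H" by blast
  qed (auto simp: P_def disjnt_def)
  moreover have "transitive_set H S" if "S \<in> P" for S
  proof -
    from that obtain c where S: "S = {u \<in> pverts H. f u mod k = c}" unfolding P_def by blast
    show ?thesis
    proof (rule transitive_setI[of _ _ f])
      fix u v assume "u \<in> S" "v \<in> S" "(u, v) \<in> parcs H"
      then show "f u < f v"
        using f[of u v] F unfolding S by (auto simp: transitive_tournament_def turan_arcs_def)
    qed (auto simp: S)
  qed
  ultimately have "chromatic_number H \<le> card P" by (rule chromatic_number_le)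
  also have "\<dots> \<le> card ((\<lambda>c. {u \<in> pverts H. f u mod k = c}) ` {..<k})"
    unfolding P_def by (intro card_mono) auto
  also have "\<dots> \<le> k" using card_image_le[of "{..<k}"] by fastforce
  finally show False using assms(3) by simp
qed

section \<open>The Erdos--Stone theorem\<close>

text \<open>
  An edge of the graph \<open>R\<close> is a pair in both orientations. The parts are disjoint when \<open>R\<close> is
  irreflexive and \<open>m > 0\<close>.
\<close>
definition complete_multipartite ::
    "('a \<times> 'a) set \<Rightarrow> 'a set \<Rightarrow> nat \<Rightarrow> nat \<Rightarrow> (nat \<Rightarrow> 'a set) \<Rightarrow> bool" where
  "complete_multipartite R V k m A \<longleftrightarrow>
     (\<forall>i<k. A i \<subseteq> V \<and> card (A i) = m) \<and> (\<forall>i<k. \<forall>j<k. i \<noteq> j \<longrightarrow> A i \<times> A j \<subseteq> R)"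

lemma complete_multipartite_mono:
  assumes "complete_multipartite R S k m A" and "S \<subseteq> V"
  shows "complete_multipartite R V k m A"
  using assms unfolding complete_multipartite_def by blast

text \<open>
  Count the non-adjacent pairs between \<open>V\<close> and the \<open>K\<close> parts of size \<open>M\<close>. The degree hypothesis
  allows at most \<open>M(1 - \<epsilon>)|V|\<close> of them, while every vertex outside \<open>W\<close> accounts for at least
  \<open>M - m\<close>. Since \<open>M\<epsilon>\<close> exceeds \<open>m\<close> by at least one, \<open>W\<close> contains at least the proportion \<open>1 / M\<close> of \<open>V\<close>.
\<close>
lemma card_common_neighbours_ge:
  fixes \<epsilon> :: real
  assumes "finite V" and A: "complete_multipartite R V K M A"
    and deg: "\<And>v. v \<in> V \<Longrightarrow> real K * real (card {u \<in> V. (v, u) \<notin> R}) \<le> (1 - \<epsilon>) * real (card V)"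
    and "K > 0" and M: "real M * \<epsilon> \<ge> real m + 1"
  defines "W \<equiv> {u \<in> V. \<forall>i<K. m \<le> card {a \<in> A i. (a, u) \<in> R}}"
  shows "card V \<le> card W * M"
proof -
  let ?miss = "\<lambda>i u. card {a \<in> A i. (a, u) \<notin> R}"
  have fin: "finite (A i)" and sub: "A i \<subseteq> V" and card_A: "card (A i) = M" if "i < K" for i
    using A that finite_subset[OF _ \<open>finite V\<close>] unfolding complete_multipartite_def by auto
  have "finite W" "W \<subseteq> V" unfolding W_def using \<open>finite V\<close> by auto
  \<comment> \<open>A vertex outside \<open>W\<close> already misses more than \<open>M - m\<close> vertices of a single part.\<close>
  have outside: "real M - real m \<le> real (\<Sum>i<K. ?miss i u)" if "u \<in> V - W" for u
  proof -
    from that obtain i where i: "i < K" "card {a \<in> A i. (a, u) \<in> R} < m"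
      unfolding W_def by (auto simp: not_le)
    have "card (A i) = card {a \<in> A i. (a, u) \<in> R} + ?miss i u"
      using fin[OF i(1)] by (subst card_Un_disjoint[symmetric]) (auto intro!: arg_cong[where f = card])
    then have "M \<le> m + ?miss i u"
      using i card_A[OF i(1)] by linarith
    moreover have "?miss i u \<le> (\<Sum>i<K. ?miss i u)"
      using i(1) by (intro member_le_sum) auto
    ultimately show ?thesis by linarith
  qed
  have "(real (card V) - real (card W)) * (real M - real m) = (\<Sum>u\<in>V - W. real M - real m)"
    using \<open>finite W\<close> \<open>W \<subseteq> V\<close> \<open>finite V\<close> by (simp add: card_Diff_subset card_mono of_nat_diff)
  also have "\<dots> \<le> (\<Sum>u\<in>V - W. real (\<Sum>i<K. ?miss i u))"
    by (intro sum_mono outside)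
  also have "\<dots> \<le> (\<Sum>u\<in>V. real (\<Sum>i<K. ?miss i u))"
    using \<open>finite V\<close> by (intro sum_mono2) (auto intro: sum_nonneg)
  also have "\<dots> = real (\<Sum>i<K. \<Sum>u\<in>V. ?miss i u)"
    by (simp add: sum.swap[of _ V])
  also have "(\<Sum>i<K. \<Sum>u\<in>V. ?miss i u) = (\<Sum>i<K. \<Sum>a\<in>A i. card {u \<in> V. (a, u) \<notin> R})"
    using fin \<open>finite V\<close> by (intro sum.cong refl sum_multicount_gen) auto
  also have "real \<dots> \<le> real M * (1 - \<epsilon>) * real (card V)"
  proof -
    have "real K * real (\<Sum>i<K. \<Sum>a\<in>A i. card {u \<in> V. (a, u) \<notin> R})
        = (\<Sum>i<K. \<Sum>a\<in>A i. real K * real (card {u \<in> V. (a, u) \<notin> R}))"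
      by (simp add: sum_distrib_left)
    also have "\<dots> \<le> (\<Sum>i<K. \<Sum>a\<in>A i. (1 - \<epsilon>) * real (card V))"
      using sub by (intro sum_mono deg) auto
    also have "\<dots> = real K * (real M * (1 - \<epsilon>) * real (card V))"
      using card_A by simp
    finally show ?thesis using \<open>K > 0\<close> by simp
  qed
  finally have "real (card V) * (real M * \<epsilon> - real m) \<le> real (card W) * (real M - real m)"
    by (simp add: algebra_simps)
  moreover have "real (card V) * 1 \<le> real (card V) * (real M * \<epsilon> - real m)"
    using M by (intro mult_left_mono) auto
  moreover have "real (card W) * (real M - real m) \<le> real (card W) * real M"
    by (intro mult_left_mono) auto
  ultimately have "real (card V) \<le> real (card W * M)" by simp
  then show ?thesis by (simp only: of_nat_le_iff)
qed

lemma large_fibre: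
  assumes "finite W" and "finite P" and "f ` W \<subseteq> P" and "m * card P < card W"
  shows "\<exists>p\<in>f ` W. m \<le> card {x \<in> W. f x = p}"
proof (rule ccontr)
  assume "\<not> ?thesis"
  then have small: "card {x \<in> W. f x = p} \<le> m" if "p \<in> f ` W" for p
    using that by fastforce
  have "card W = card (\<Union>p\<in>f ` W. {x \<in> W. f x = p})"
    by (rule arg_cong[where f = card]) auto
  also have "\<dots> \<le> (\<Sum>p\<in>f ` W. card {x \<in> W. f x = p})"
    using assms by (intro card_UN_le) auto
  also have "\<dots> \<le> card (f ` W) * m"
    using small by (intro sum_bounded_above[THEN order_trans]) auto
  also have "\<dots> \<le> card P * m"
    using assms by (intro mult_right_mono card_mono) auto
  finally show False using assms by (simp add: mult.commute)
qed

text \<open>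
  The minimum-degree form of the Erdos--Stone theorem. Induction on the number of parts:
  given parts of some large size \<open>M\<close>, linearly many vertices have at least \<open>m\<close> neighbours in every
  part, and by the pigeonhole principle many of these share the same \<open>m\<close> neighbours in each part.
  The hypothesis bounds non-neighbours, multiplied by \<open>k\<close>, so that it is meaningful for \<open>k = 0\<close>.
\<close>
lemma complete_multipartite_of_min_degree:
  fixes \<epsilon> :: real
  assumes "\<epsilon> > 0"
  shows "\<exists>N. \<forall>(V :: 'a set) R. finite V \<and> N \<le> card V \<and> sym R \<and>
           (\<forall>v\<in>V. real k * real (card {u \<in> V. (v, u) \<notin> R}) \<le> (1 - \<epsilon>) * real (card V)) \<longrightarrow>
           (\<exists>A. complete_multipartite R V (Suc k) m A)"
proof (induction k arbitrary: m)
  case 0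
  show ?case
  proof (intro exI[of _ m] allI impI, elim conjE)
    fix V :: "'a set" and R :: "'a rel"
    assume "m \<le> card V"
    then obtain B where "B \<subseteq> V" "card B = m"
      by (meson obtain_subset_with_card_n)
    then show "\<exists>A. complete_multipartite R V (Suc 0) m A"
      unfolding complete_multipartite_def by (intro exI[of _ "\<lambda>_. B"]) auto
  qed
next
  case (Suc k)
  define K where "K = Suc k"
  \<comment> \<open>Parts of size \<open>M\<close> for the smaller number of parts are cut down to size \<open>m\<close> when the next part is added.\<close>
  obtain M :: nat where M: "(real m + 1) / \<epsilon> \<le> real M"
    using real_arch_simple by blast
  then have M: "real M * \<epsilon> \<ge> real m + 1"
    using assms by (simp add: field_simps)
  then have "M > 0" by (cases M) auto
  obtain N where N: "\<And>(V :: 'a set) R. \<lbrakk>finite V; N \<le> card V; sym R;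
      \<forall>v\<in>V. real k * real (card {u \<in> V. (v, u) \<notin> R}) \<le> (1 - \<epsilon>) * real (card V)\<rbrakk> \<Longrightarrow>
      \<exists>A. complete_multipartite R V K M A"
    using Suc.IH[of M] unfolding K_def by blast
  let ?p = "(2 ^ M) ^ K :: nat"
  show ?case
  proof (intro exI[of _ "max N ((m * ?p + 1) * M)"] allI impI, elim conjE)
    fix V :: "'a set" and R :: "'a rel"
    assume fin: "finite V" and large: "max N ((m * ?p + 1) * M) \<le> card V" and "sym R"
      and deg: "\<forall>v\<in>V. real (Suc k) * real (card {u \<in> V. (v, u) \<notin> R}) \<le> (1 - \<epsilon>) * real (card V)"
    \<comment> \<open>With \<open>k\<close> in place of \<open>Suc k\<close> the degree hypothesis only becomes weaker.\<close>
    have "\<forall>v\<in>V. real k * real (card {u \<in> V. (v, u) \<notin> R}) \<le> (1 - \<epsilon>) * real (card V)"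
    proof
      fix v assume "v \<in> V"
      have "real k * real (card {u \<in> V. (v, u) \<notin> R}) \<le> real (Suc k) * real (card {u \<in> V. (v, u) \<notin> R})"
        by (intro mult_right_mono) auto
      then show "real k * real (card {u \<in> V. (v, u) \<notin> R}) \<le> (1 - \<epsilon>) * real (card V)"
        using deg \<open>v \<in> V\<close> by fastforce
    qed
    then obtain A where A: "complete_multipartite R V K M A"
      using N[OF fin _ \<open>sym R\<close>] large by auto
    have A': "A i \<subseteq> V" "card (A i) = M" "finite (A i)" if "i < K" for i
      using A that finite_subset[OF _ fin] unfolding complete_multipartite_def by auto
    define W where "W = {u \<in> V. \<forall>i<K. m \<le> card {a \<in> A i. (a, u) \<in> R}}"
    have "finite W" "W \<subseteq> V" unfolding W_def using fin by auto
    have "card V \<le> card W * M"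
      unfolding W_def using deg
      by (intro card_common_neighbours_ge[OF fin A _ _ M]) (auto simp: K_def)
    then have "(m * ?p + 1) * M \<le> card W * M" using large by linarith
    then have "m * ?p + 1 \<le> card W" using \<open>M > 0\<close> by (simp only: mult_le_cancel2)
    then have W_large: "m * ?p < card W" by simp
    \<comment> \<open>A vertex of \<open>W\<close> selects an \<open>m\<close>-set of its neighbours in every part, and there are at most
      \<open>?p\<close> selections; some \<open>m\<close> vertices \<open>C\<close> with a common selection \<open>B\<close> form the new part.\<close>
    have "\<exists>B. B \<in> PiE {..<K} (\<lambda>i. Pow (A i)) \<and> (\<forall>i<K. card (B i) = m \<and> B i \<times> {u} \<subseteq> R)"
      if "u \<in> W" for u
    proof -
      have "\<forall>i<K. \<exists>B. B \<subseteq> {a \<in> A i. (a, u) \<in> R} \<and> card B = m"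
        using that unfolding W_def by (auto intro: obtain_subset_with_card_n)
      then obtain B where "\<forall>i<K. B i \<subseteq> {a \<in> A i. (a, u) \<in> R} \<and> card (B i) = m"
        by metis
      then show ?thesis
        by (intro exI[of _ "restrict B {..<K}"]) auto
    qed
    then obtain \<phi> where \<phi>: "\<And>u. u \<in> W \<Longrightarrow> \<phi> u \<in> PiE {..<K} (\<lambda>i. Pow (A i))"
      "\<And>u i. u \<in> W \<Longrightarrow> i < K \<Longrightarrow> card (\<phi> u i) = m \<and> \<phi> u i \<times> {u} \<subseteq> R"
      by metis
    have "card (PiE {..<K} (\<lambda>i. Pow (A i))) = (\<Prod>i<K. 2 ^ M)"
      using A' by (simp add: card_PiE card_Pow)
    then have cardP: "card (PiE {..<K} (\<lambda>i. Pow (A i))) = ?p" by simp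
    have finP: "finite (PiE {..<K} (\<lambda>i. Pow (A i)))"
      using A' by (intro finite_PiE) auto
    obtain B where B: "B \<in> \<phi> ` W" "m \<le> card {u \<in> W. \<phi> u = B}"
      using large_fibre[OF \<open>finite W\<close> finP, of \<phi> m] \<phi>(1) W_large cardP by auto
    obtain C where C: "C \<subseteq> {u \<in> W. \<phi> u = B}" "card C = m"
      using B(2) by (meson obtain_subset_with_card_n)
    have B': "B i \<subseteq> A i" "card (B i) = m" "B i \<times> C \<subseteq> R" "C \<times> B i \<subseteq> R" if "i < K" for i
    proof -
      show "B i \<subseteq> A i" "card (B i) = m" using B(1) \<phi> that by (auto simp: PiE_def Pi_def)
      show BC: "B i \<times> C \<subseteq> R" using C(1) \<phi>(2) that by blast
      show "C \<times> B i \<subseteq> R" using BC \<open>sym R\<close> by (auto dest: symD)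
    qed
    have "complete_multipartite R V (Suc K) m (\<lambda>i. if i < K then B i else C)"
      unfolding complete_multipartite_def
    proof (intro conjI allI impI)
      fix i assume "i < Suc K"
      show "(if i < K then B i else C) \<subseteq> V"
        using B'(1)[of i] A'(1)[of i] C(1) \<open>W \<subseteq> V\<close> by auto
      show "card (if i < K then B i else C) = m"
        using B'(2) C(2) by auto
    next
      fix i j assume "i < Suc K" "j < Suc K" "i \<noteq> j"
      consider "i < K" "j < K" | "i < K" "j = K" | "i = K" "j < K"
        using \<open>i < Suc K\<close> \<open>j < Suc K\<close> \<open>i \<noteq> j\<close> by linarith
      then show "(if i < K then B i else C) \<times> (if j < K then B j else C) \<subseteq> R"
      proof cases
        case 1
        then have "A i \<times> A j \<subseteq> R"
          using A \<open>i \<noteq> j\<close> unfolding complete_multipartite_def by blast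
        then show ?thesis using B'(1)[of i] B'(1)[of j] 1 by auto
      qed (use B'(3,4) in auto)
    qed
    then show "\<exists>A. complete_multipartite R V (Suc (Suc k)) m A"
      unfolding K_def by blast
  qed
qed

text \<open>
  Passing to a subset of large minimum degree: take \<open>S\<close> maximising the number of arcs minus
  \<open>a|S|(|S| + 1)\<close>. Deleting a vertex of degree below \<open>a|S|\<close> would increase this quantity.
\<close>
lemma dense_subset_with_min_degree:
  fixes a :: real
  assumes "finite V" and "sym R"
  obtains S where "S \<subseteq> V"
    and "\<And>v. v \<in> S \<Longrightarrow> a * real (card S) \<le> real (card {u \<in> S. (v, u) \<in> R})"
    and "real (card (R \<inter> V \<times> V)) - a * real (card V) * (real (card V) + 1)
         \<le> real (card (R \<inter> S \<times> S)) - a * real (card S) * (real (card S) + 1)"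
proof -
  define f where "f S = real (card (R \<inter> S \<times> S)) - a * real (card S) * (real (card S) + 1)" for S
  have fin: "finite (f ` Pow V)" using \<open>finite V\<close> by simp
  then have "Max (f ` Pow V) \<in> f ` Pow V" by (intro Max_in) auto
  then obtain S where "S \<in> Pow V" and S_max: "f S = Max (f ` Pow V)" by auto
  have max: "f T \<le> f S" if "T \<subseteq> V" for T
    unfolding S_max using fin that by (intro Max_ge) auto
  have "S \<subseteq> V" "finite S" using \<open>S \<in> Pow V\<close> \<open>finite V\<close> finite_subset by auto
  have "a * real (card S) \<le> real (card {u \<in> S. (v, u) \<in> R})" if "v \<in> S" for v
  proof -
    \<comment> \<open>Deleting a vertex lowers \<open>a|S|(|S| + 1)\<close> by \<open>2a|S|\<close> and the arc count by at most
      twice its degree.\<close>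
    let ?T = "S - {v}" and ?D = "{u \<in> S. (v, u) \<in> R}"
    have "R \<inter> S \<times> S \<subseteq> (R \<inter> ?T \<times> ?T) \<union> (Pair v ` ?D \<union> (\<lambda>u. (u, v)) ` ?D)"
      using \<open>sym R\<close> by (auto dest: symD)
    then have "card (R \<inter> S \<times> S) \<le> card ((R \<inter> ?T \<times> ?T) \<union> (Pair v ` ?D \<union> (\<lambda>u. (u, v)) ` ?D))"
      using \<open>finite S\<close> by (intro card_mono) auto
    also have "\<dots> \<le> card (R \<inter> ?T \<times> ?T) + (card (Pair v ` ?D) + card ((\<lambda>u. (u, v)) ` ?D))"
      by (intro card_Un_le[THEN order_trans] add_left_mono card_Un_le)
    also have "\<dots> \<le> card (R \<inter> ?T \<times> ?T) + (card ?D + card ?D)"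
      using \<open>finite S\<close> by (intro add_mono card_image_le) auto
    finally have edges: "real (card (R \<inter> S \<times> S)) \<le> real (card (R \<inter> ?T \<times> ?T)) + 2 * real (card ?D)"
      by linarith
    have "real (card ?T) = real (card S) - 1"
      using card_Suc_Diff1[OF \<open>finite S\<close> that] by linarith
    then have "f ?T = real (card (R \<inter> ?T \<times> ?T)) - a * (real (card S) - 1) * real (card S)"
      unfolding f_def by simp
    moreover have "f ?T \<le> f S" using \<open>S \<subseteq> V\<close> by (intro max) auto
    ultimately show ?thesis
      using edges unfolding f_def by (simp add: algebra_simps)
  qed
  then show thesis
    using that[OF \<open>S \<subseteq> V\<close>] max[of V] unfolding f_def by auto
qed

text \<open>
  The Erdos--Stone theorem: in large graphs, a density exceeding \<open>1 - 1 / k\<close> by a constant forces complete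
  \<open>(k + 1)\<close>-partite subgraphs with parts of any fixed size. It reduces to the minimum-degree form on a
  subset \<open>S\<close>, which retains enough of the surplus of arcs to be large itself. As \<open>R\<close> contains each edge in both orientations,
  its density is measured against \<open>n(n - 1)\<close>.
\<close>
theorem erdos_stone:
  fixes \<delta> :: real
  assumes "k > 0" and "\<delta> > 0"
  obtains N where "\<And>(V :: 'a set) R. \<lbrakk>finite V; N \<le> card V; sym R; R \<subseteq> V \<times> V;
      (1 - 1 / real k + \<delta>) * (real (card V) * (real (card V) - 1)) \<le> real (card R)\<rbrakk> \<Longrightarrow>
      \<exists>A. complete_multipartite R V (Suc k) m A"
proof -
  \<comment> \<open>Half of the surplus \<open>\<delta>\<close> is kept in the degree bound; the other half makes the dense subset \<open>S\<close> large.\<close>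
  define a where "a = 1 - 1 / real k + \<delta> / 2"
  have "a \<ge> 0" using assms unfolding a_def by (intro add_nonneg_nonneg) auto
  have half: "real k * \<delta> / 2 > 0" using assms by simp
  obtain N where N: "\<forall>(S :: 'a set) R. finite S \<and> N \<le> card S \<and> sym R \<and>
      (\<forall>v\<in>S. real k * real (card {u \<in> S. (v, u) \<notin> R}) \<le> (1 - real k * \<delta> / 2) * real (card S)) \<longrightarrow>
      (\<exists>A. complete_multipartite R S (Suc k) m A)"
    using complete_multipartite_of_min_degree[OF half, of k m] by (rule exE)
  obtain N' :: nat where N': "(2 * a + 1) * 2 / \<delta> + 1 \<le> real N'"
    using real_arch_simple by blast
  show thesis
  proof (rule that[of "max N' (N ^ 2)"])
    fix V :: "'a set" and R :: "'a rel"
    assume "finite V" and large: "max N' (N ^ 2) \<le> card V" and "sym R" and "R \<subseteq> V \<times> V"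
      and dense: "(1 - 1 / real k + \<delta>) * (real (card V) * (real (card V) - 1)) \<le> real (card R)"
    obtain S where S: "S \<subseteq> V"
      and deg: "\<And>v. v \<in> S \<Longrightarrow> a * real (card S) \<le> real (card {u \<in> S. (v, u) \<in> R})"
      and excess: "real (card (R \<inter> V \<times> V)) - a * real (card V) * (real (card V) + 1)
         \<le> real (card (R \<inter> S \<times> S)) - a * real (card S) * (real (card S) + 1)"
      using dense_subset_with_min_degree[OF \<open>finite V\<close> \<open>sym R\<close>, of a] by blast
    have "finite S" using S \<open>finite V\<close> finite_subset by blast
    \<comment> \<open>The surplus inherited by \<open>S\<close> is at least \<open>|V|\<close>, and \<open>S\<close> spans at most \<open>|S|\<^sup>2\<close> ordered pairs.\<close>
    have "N \<le> card S"
    proof -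
      let ?n = "real (card V)"
      have "(2 * a + 1) * 2 / \<delta> \<le> ?n - 1" using N' large by linarith
      then have "2 * a + 1 \<le> \<delta> / 2 * (?n - 1)" using assms by (simp add: field_simps)
      then have "?n * 1 \<le> ?n * (\<delta> / 2 * (?n - 1) - 2 * a)" by (intro mult_left_mono) auto
      also have "\<dots> = (1 - 1 / real k + \<delta>) * (?n * (?n - 1)) - a * ?n * (?n + 1)"
        unfolding a_def by (simp add: algebra_simps add_divide_distrib diff_divide_distrib)
      also have "\<dots> \<le> real (card (R \<inter> V \<times> V)) - a * ?n * (?n + 1)"
        using dense \<open>R \<subseteq> V \<times> V\<close> by (simp add: Int_absorb2)
      also have "\<dots> \<le> real (card (R \<inter> S \<times> S))"
        using excess \<open>a \<ge> 0\<close> by (smt (verit) mult_nonneg_nonneg of_nat_0_le_iff)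
      also have "card (R \<inter> S \<times> S) \<le> card (S \<times> S)"
        using \<open>finite S\<close> by (intro card_mono) auto
      finally have "card V \<le> card S ^ 2"
        by (simp add: card_cartesian_product power2_eq_square flip: of_nat_mult)
      then have "N ^ 2 \<le> card S ^ 2" using large by linarith
      then show ?thesis by (simp only: power2_nat_le_eq_le)
    qed
    moreover have "real k * real (card {u \<in> S. (v, u) \<notin> R}) \<le> (1 - real k * \<delta> / 2) * real (card S)"
      if "v \<in> S" for v
    proof -
      have "card S = card {u \<in> S. (v, u) \<in> R} + card {u \<in> S. (v, u) \<notin> R}"
        using \<open>finite S\<close> by (subst card_Un_disjoint[symmetric]) (auto intro!: arg_cong[where f = card])
      then have "real (card {u \<in> S. (v, u) \<notin> R}) \<le> (1 - a) * real (card S)"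
        using deg[OF that] by (simp add: algebra_simps)
      then have "real k * real (card {u \<in> S. (v, u) \<notin> R}) \<le> real k * ((1 - a) * real (card S))"
        by (intro mult_left_mono) auto
      also have "\<dots> = (1 - real k * \<delta> / 2) * real (card S)"
        using \<open>k > 0\<close> by (simp add: a_def field_simps)
      finally show ?thesis .
    qed
    ultimately obtain A where "complete_multipartite R S (Suc k) m A"
      using N[THEN spec, THEN spec, of S R] \<open>finite S\<close> \<open>sym R\<close> by blast
    then show "\<exists>A. complete_multipartite R V (Suc k) m A"
      using complete_multipartite_mono[OF _ S] by blast
  qed
qed

section \<open>Embedding into a multipartite graph of bidirectional pairs\<close>

text \<open>
  One of the out- and in-neighbourhoods of any vertex contains at least half of the remaining ones; the
  vertex is put in front of, or after, a sequence found there.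
\<close>
lemma sorted_sequence_in_tournament:
  assumes "finite V" and "2 ^ h \<le> card V"
    and "\<And>u v. \<lbrakk>u \<in> V; v \<in> V; u \<noteq> v\<rbrakk> \<Longrightarrow> (u, v) \<in> E \<or> (v, u) \<in> E"
  shows "\<exists>xs. length xs = h \<and> set xs \<subseteq> V \<and> sorted_wrt (\<lambda>u v. (u, v) \<in> E) xs"
  using assms
proof (induction h arbitrary: V)
  case 0
  then show ?case by auto
next
  case (Suc h)
  have "card V > 0" using Suc.prems(2) by (metis neq0_conv not_less zero_less_numeral zero_less_power)
  then obtain v where "v \<in> V" by fastforce
  let ?out = "{u \<in> V - {v}. (v, u) \<in> E}" and ?in = "{u \<in> V - {v}. (u, v) \<in> E}"
  have "V - {v} \<subseteq> ?out \<union> ?in" using Suc.prems(3) \<open>v \<in> V\<close> by blast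
  then have "card (V - {v}) \<le> card (?out \<union> ?in)" using \<open>finite V\<close> by (intro card_mono) auto
  also have "\<dots> \<le> card ?out + card ?in" by (rule card_Un_le)
  finally have "2 * 2 ^ h \<le> card ?out + card ?in + 1"
    using Suc.prems(2) \<open>v \<in> V\<close> by (simp add: card_Diff_singleton)
  then consider "2 ^ h \<le> card ?out" | "2 ^ h \<le> card ?in" by linarith
  then show ?case
  proof cases
    case 1
    with Suc.IH[of ?out] Suc.prems obtain xs
      where "length xs = h" "set xs \<subseteq> ?out" "sorted_wrt (\<lambda>u v. (u, v) \<in> E) xs" by auto
    then show ?thesis using \<open>v \<in> V\<close> by (intro exI[of _ "v # xs"]) auto
  next
    case 2
    with Suc.IH[of ?in] Suc.prems obtain xs
      where "length xs = h" "set xs \<subseteq> ?in" "sorted_wrt (\<lambda>u v. (u, v) \<in> E) xs" by auto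
    then show ?thesis using \<open>v \<in> V\<close> by (intro exI[of _ "xs @ [v]"]) (auto simp: sorted_wrt_append)
  qed
qed

text \<open>
  Take an optimal colouring of \<open>H\<close>. Every part contains a transitive subtournament on as many
  vertices as \<open>H\<close> has, which accommodates a whole colour class; arcs between different classes are
  free, since both orientations are present between different parts.
\<close>
lemma contains_copy_if_multipartite:
  assumes G: "tournament G" and H: "tournament H" and F: "F \<subseteq> parcs G"
    and A: "complete_multipartite (F \<union> F\<inverse>) (pverts G) (chromatic_number H) (2 ^ card (pverts H)) A"
  shows "contains_copy (add_reverses G F) H"
proof -
  note GD = tournamentD[OF G] and HD = tournamentD[OF H]
  let ?h = "card (pverts H)"
  obtain P where P: "partition_on (pverts H) P" "card P = chromatic_number H"
    and trans: "\<And>S. S \<in> P \<Longrightarrow> transitive_set H S"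
    using optimal_colouring[OF H] by blast
  have "finite P" using P(1) HD(1) by (rule finite_elements[rotated])
  then obtain colour where "bij_betw colour P {0..<card P}"
    using ex_bij_betw_finite_nat by blast
  then have colour: "\<And>S. S \<in> P \<Longrightarrow> colour S < chromatic_number H" "inj_on colour P"
    using P(2) by (auto simp: bij_betw_def)
  have "\<exists>xs. length xs = ?h \<and> set xs \<subseteq> A i \<and> sorted_wrt (\<lambda>u v. (u, v) \<in> parcs G) xs"
    if "i < chromatic_number H" for i
  proof (rule sorted_sequence_in_tournament)
    have Ai: "A i \<subseteq> pverts G" "card (A i) = 2 ^ ?h"
      using A that unfolding complete_multipartite_def by auto
    then show "finite (A i)" "2 ^ ?h \<le> card (A i)" using GD(1) finite_subset by auto
    show "(u, v) \<in> parcs G \<or> (v, u) \<in> parcs G" if "u \<in> A i" "v \<in> A i" "u \<noteq> v" for u v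
      using GD(7) Ai(1) that by blast
  qed
  then obtain xs where xs: "\<And>i. i < chromatic_number H \<Longrightarrow>
      length (xs i) = ?h \<and> set (xs i) \<subseteq> A i \<and> sorted_wrt (\<lambda>u v. (u, v) \<in> parcs G) (xs i)"
    by metis
  have "\<exists>g. (\<forall>u\<in>S. g u < ?h) \<and> (\<forall>u\<in>S. \<forall>v\<in>S. (u, v) \<in> parcs H \<longrightarrow> g u < (g v :: nat))" if "S \<in> P" for S
    using transitive_set_rank[OF H trans[OF that]] by metis
  then obtain rank where rank: "\<And>S u. S \<in> P \<Longrightarrow> u \<in> S \<Longrightarrow> rank S u < ?h"
    "\<And>S u v. \<lbrakk>S \<in> P; u \<in> S; v \<in> S; (u, v) \<in> parcs H\<rbrakk> \<Longrightarrow> rank S u < (rank S v :: nat)"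
    by metis
  have "\<forall>u\<in>pverts H. \<exists>S\<in>P. u \<in> S" using P(1) by (auto simp: partition_on_def)
  then obtain part where part: "\<And>u. u \<in> pverts H \<Longrightarrow> part u \<in> P \<and> u \<in> part u" by metis
  \<comment> \<open>Each colour class goes into its own part, its vertices in order of rank along the sorted sequence.\<close>
  define f where "f u = xs (colour (part u)) ! rank (part u) u" for u
  have f_in: "f u \<in> A (colour (part u))" if "u \<in> pverts H" for u
    using xs[of "colour (part u)"] colour(1)[of "part u"] rank(1)[of "part u" u] part[OF that]
    unfolding f_def by (metis nth_mem subsetD)
  have hom: "(f u, f v) \<in> parcs (add_reverses G F)" if uv: "(u, v) \<in> parcs H" for u v
  proof -
    have u: "u \<in> pverts H" and v: "v \<in> pverts H" using uv HD(3) by auto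
    note i = colour(1)[OF conjunct1[OF part[OF u]]] and j = colour(1)[OF conjunct1[OF part[OF v]]]
    show ?thesis
    proof (cases "part u = part v")
      case True
      then have "rank (part v) u < rank (part v) v" "rank (part v) v < ?h"
        using rank part[OF u] part[OF v] uv by metis+
      then have "(f u, f v) \<in> parcs G"
        using xs[OF j] True unfolding f_def by (simp add: sorted_wrt_iff_nth_less)
      then show ?thesis by simp
    next
      case False
      then have "colour (part u) \<noteq> colour (part v)"
        using colour(2) part[OF u] part[OF v] by (meson inj_onD)
      then have "A (colour (part u)) \<times> A (colour (part v)) \<subseteq> F \<union> F\<inverse>"
        using A i j unfolding complete_multipartite_def by blast
      then show ?thesis using f_in[OF u] f_in[OF v] F by auto
    qed
  qed
  have "inj_on f (pverts H)"
  proof (rule inj_onI, rule ccontr)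
    fix u v assume "u \<in> pverts H" "v \<in> pverts H" "f u = f v" "u \<noteq> v"
    then have "(f u, f u) \<in> parcs (add_reverses G F)"
      using HD(7)[of u v] hom[of u v] hom[of v u] by auto
    then show False using GD(5) F by auto
  qed
  moreover have "f ` pverts H \<subseteq> pverts G"
    using f_in A colour(1) part unfolding complete_multipartite_def by blast
  moreover have "pair_wf_digraph (add_reverses G F)"
    using GD(3) F by unfold_locales auto
  ultimately show ?thesis
    using hom HD(4) by (intro contains_copyI[of H _ f]) auto
qed

lemma twice_choose_two: "real n * (real n - 1) = 2 * real (n choose 2)"
  by (induction n) (simp_all add: numeral_2_eq_2 algebra_simps)

text \<open>
  \<open>t\<close> added arcs make \<open>2t\<close> ordered pairs of the graph of bidirectional pairs, to which \<open>erdos_stone\<close> applies.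
\<close>
lemma eventually_forces_copy:
  fixes H :: "'b pair_pre_digraph" and \<delta> :: real
  assumes "tournament H" and "chromatic_number H = Suc k" and "k > 0" and "\<delta> > 0"
  shows "\<forall>\<^sub>F n in sequentially. \<forall>t. (1 - 1 / real k + \<delta>) * real (n choose 2) \<le> real t \<longrightarrow>
           (\<forall>G :: 'a pair_pre_digraph. tournament G \<and> card (pverts G) = n \<longrightarrow> forces_copy G t H)"
proof -
  obtain N where N: "\<And>(V :: 'a set) R. \<lbrakk>finite V; N \<le> card V; sym R; R \<subseteq> V \<times> V;
      (1 - 1 / real k + \<delta>) * (real (card V) * (real (card V) - 1)) \<le> real (card R)\<rbrakk> \<Longrightarrow>
      \<exists>A. complete_multipartite R V (Suc k) (2 ^ card (pverts H)) A"
    using erdos_stone[OF \<open>k > 0\<close> \<open>\<delta> > 0\<close>] by blast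
  show ?thesis
    unfolding eventually_sequentially forces_copy_def
  proof (intro exI[of _ N] allI impI, elim conjE)
    fix n t and G :: "'a pair_pre_digraph" and F
    assume "N \<le> n" and t: "(1 - 1 / real k + \<delta>) * real (n choose 2) \<le> real t"
      and G: "tournament G" "card (pverts G) = n" and F: "F \<subseteq> parcs G" "card F = t"
    note GD = tournamentD[OF G(1)]
    have "finite F" using F(1) GD(2) finite_subset by blast
    moreover have "F \<inter> F\<inverse> = {}" using F(1) GD(6) by blast
    ultimately have "card (F \<union> F\<inverse>) = 2 * t"
      using F(2) by (simp add: card_Un_disjoint)
    then have "(1 - 1 / real k + \<delta>) * (real n * (real n - 1)) \<le> real (card (F \<union> F\<inverse>))"
      using t by (simp add: twice_choose_two)
    then obtain A where "complete_multipartite (F \<union> F\<inverse>) (pverts G) (Suc k) (2 ^ card (pverts H)) A"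
      using N[OF GD(1), of "F \<union> F\<inverse>"] \<open>N \<le> n\<close> G(2) F(1) GD(3) by (auto simp: sym_Un_converse)
    then show "contains_copy (add_reverses G F) H"
      using contains_copy_if_multipartite[OF G(1) \<open>tournament H\<close> F(1)] assms(2) by simp
  qed
qed

section \<open>The two thresholds\<close>

lemma forces_copy_vacuous:
  assumes "finite (parcs G)" and "card (parcs G) < t"
  shows "forces_copy G t H"
  unfolding forces_copy_def using assms by (metis card_mono leD)

text \<open>
  The minimum is attained because \<open>n\<^sup>2 + 1\<close> arcs can never be chosen, which makes the condition vacuous there.
\<close>
lemma forces_copy_t_num:
  fixes G :: "nat pair_pre_digraph"
  assumes "tournament G" and "card (pverts G) = n"
  shows "forces_copy G (t_num n H) H"
proof -
  have "\<forall>G :: nat pair_pre_digraph. tournament G \<and> card (pverts G) = n \<longrightarrow> forces_copy G (Suc (n * n)) H"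
  proof (intro allI impI, elim conjE)
    fix G :: "nat pair_pre_digraph" assume G: "tournament G" "card (pverts G) = n"
    have "card (parcs G) \<le> card (pverts G \<times> pverts G)"
      using tournamentD[OF G(1)] by (intro card_mono) auto
    then show "forces_copy G (Suc (n * n)) H"
      using G tournamentD(2)[OF G(1)] by (intro forces_copy_vacuous) (auto simp: card_cartesian_product)
  qed
  then have "\<forall>G :: nat pair_pre_digraph. tournament G \<and> card (pverts G) = n \<longrightarrow> forces_copy G (t_num n H) H"
    unfolding t_num_def by (rule LeastI)
  then show ?thesis using assms by blast
qed

lemma forces_copy_t_trans: "forces_copy (transitive_tournament n) (t_trans n H) H"
  unfolding t_trans_def
  using forces_copy_t_num[OF tournament_transitive_tournament] by (rule LeastI)

lemma t_trans_le_t_num: "t_trans n H \<le> t_num n H"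
  unfolding t_trans_def
  using forces_copy_t_num[OF tournament_transitive_tournament] by (rule Least_le)

text \<open>
  Subsets of the Turan arcs are as harmless as the whole set, so every number up to its size
  fails to force a copy.
\<close>
lemma t_trans_ge:
  assumes "tournament H" and "k > 0" and "k < chromatic_number H"
  shows "(1 - 1 / real k) * real (n choose 2) \<le> real (t_trans n H)"
proof -
  have "card (turan_arcs k n) < t_trans n H"
  proof (rule ccontr)
    assume "\<not> card (turan_arcs k n) < t_trans n H"
    then obtain F where F: "F \<subseteq> turan_arcs k n" "card F = t_trans n H"
      by (meson not_less obtain_subset_with_card_n)
    moreover have "turan_arcs k n \<subseteq> parcs (transitive_tournament n)"
      by (auto simp: turan_arcs_def transitive_tournament_def)
    ultimately have "contains_copy (add_reverses (transitive_tournament n) F) H"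
      using forces_copy_t_trans[of n H] unfolding forces_copy_def by blast
    then show False using no_copy_in_turan_reversal[OF assms F(1)] by blast
  qed
  then show ?thesis using card_turan_arcs_ge[OF \<open>k > 0\<close>, of n] by linarith
qed

lemma eventually_t_num_le:
  fixes \<delta> :: real
  assumes "tournament H" and "chromatic_number H = Suc k" and "k > 0" and "\<delta> > 0"
  shows "\<forall>\<^sub>F n in sequentially. real (t_num n H) \<le> (1 - 1 / real k + \<delta>) * real (n choose 2) + 1"
  using eventually_forces_copy[OF assms, where ?'a = nat]
proof eventually_elim
  case (elim n)
  show ?case
  proof (rule ccontr)
    assume "\<not> ?case"
    moreover have "0 \<le> (1 - 1 / real k + \<delta>) * real (n choose 2)"
      using \<open>k > 0\<close> \<open>\<delta> > 0\<close> by (intro mult_nonneg_nonneg) (auto intro: add_nonneg_nonneg)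
    ultimately have "t_num n H > 0"
      and "(1 - 1 / real k + \<delta>) * real (n choose 2) \<le> real (t_num n H - 1)" by (auto simp: of_nat_diff)
    \<comment> \<open>So already \<open>t_num n H - 1\<close> added arcs force a copy, against minimality.\<close>
    then have "t_num n H \<le> t_num n H - 1"
      using elim unfolding t_num_def[of n H] by (intro Least_le) auto
    with \<open>t_num n H > 0\<close> show False by simp
  qed
qed

theorem proposition1p1:
  fixes r :: nat and H :: "'a pair_pre_digraph"
  assumes "r \<ge> 3" and "tournament H" and "chromatic_number H = r"
  shows "(\<forall>n \<ge> card (pverts H).
            (1 - 1 / (real r - 1)) * real (n choose 2) \<le> real (t_trans n H) \<and>
            t_trans n H \<le> t_num n H) \<and>
         (\<exists>\<epsilon> :: nat \<Rightarrow> real. \<epsilon> \<longlonglongrightarrow> 0 \<and>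
            (\<forall>n \<ge> card (pverts H).
               real (t_num n H) = (1 - 1 / (real r - 1) + \<epsilon> n) * real (n choose 2)))"
proof -
  obtain k where r: "r = Suc k" and "k > 0" using \<open>r \<ge> 3\<close> by (cases r) auto
  have chi: "chromatic_number H = Suc k" using assms(3) r by simp
  have lower: "(1 - 1 / real k) * real (n choose 2) \<le> real (t_trans n H)" for n
    using t_trans_ge[OF \<open>tournament H\<close> \<open>k > 0\<close>] chi by simp
  define \<epsilon> where "\<epsilon> n = real (t_num n H) / real (n choose 2) - (1 - 1 / real k)" for n
  \<comment> \<open>A tournament with chromatic number at least \<open>3\<close> has at least three vertices, so no division by zero occurs for these \<open>n\<close>.\<close>
  have pos: "n choose 2 > 0" if "n \<ge> card (pverts H)" for n
    using that chromatic_number_le_card[OF \<open>tournament H\<close>] assms by (simp add: zero_less_binomial)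
  have "\<epsilon> \<longlonglongrightarrow> 0"
  proof (rule tendstoI)
    fix e :: real assume "e > 0"
    have "\<forall>\<^sub>F n in sequentially. 2 / e < real n"
      by (rule eventually_compose_filterlim[OF eventually_gt_at_top filterlim_real_sequentially])
    moreover have "\<forall>\<^sub>F n in sequentially.
        real (t_num n H) \<le> (1 - 1 / real k + e / 2) * real (n choose 2) + 1"
      using \<open>e > 0\<close> by (intro eventually_t_num_le[OF \<open>tournament H\<close> chi \<open>k > 0\<close>]) simp
    ultimately show "\<forall>\<^sub>F n in sequentially. dist (\<epsilon> n) 0 < e"
      using eventually_ge_at_top[of "card (pverts H)"]
    proof eventually_elim
      case (elim n)
      let ?c = "real (n choose 2)"
      have "n \<ge> 3" using elim(3) chromatic_number_le_card[OF \<open>tournament H\<close>] assms by simp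
      then have "real n * 2 \<le> real n * (real n - 1)" by (intro mult_left_mono) auto
      then have "real n \<le> ?c" by (simp add: twice_choose_two)
      then have "2 / e < ?c" using elim(1) by linarith
      moreover have "?c > 0" using pos[OF elim(3)] by simp
      ultimately have "1 < e / 2 * ?c" using \<open>e > 0\<close> by (simp add: field_simps)
      then have "real (t_num n H) < (1 - 1 / real k + e) * ?c"
        using elim(2) by (simp add: algebra_simps)
      then have "\<epsilon> n < e"
        using \<open>?c > 0\<close> unfolding \<epsilon>_def by (simp add: field_simps)
      moreover have "(1 - 1 / real k) * ?c \<le> real (t_num n H)"
        using lower[of n] t_trans_le_t_num[of n H] by linarith
      then have "\<epsilon> n \<ge> 0"
        using \<open>?c > 0\<close> unfolding \<epsilon>_def by (simp add: pos_le_divide_eq)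
      ultimately show ?case by simp
    qed
  qed
  moreover have "real (t_num n H) = (1 - 1 / (real r - 1) + \<epsilon> n) * real (n choose 2)"
    if "n \<ge> card (pverts H)" for n
    using pos[OF that] by (simp add: \<epsilon>_def r)
  ultimately show ?thesis
    using lower t_trans_le_t_num by (auto simp: r)
qed

end
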